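(* For all $n\ge 3$, $|C_n| = |B_{n-2}|$.
   Context: $S_n$ is the set of permutations of $\{1,\dots,n\}$ written in one-line notation. A permutation $\pi\in S_n$ avoids $132$ if there are no indices $i<j<k$ with $\pi_i<\pi_k<\pi_j$. Let $\mathcal{A}^{(2)}_n$ be the set of $\pi\in S_n$ that avoid $132$ and satisfy $|\pi_{i+1}-\pi_i|\le 2$ for all $1\le i<n$. Define $B_n=\{\pi\in\mathcal{A}^{(2)}_n : \pi_1=n\}$ and $C_n=\{\pi\in\mathcal{A}^{(2)}_n : \pi_2=n\}$. *)

theory Defs
  imports "HOL-Combinatorics.Permutations"
begin

text \<open>
  A permutation in \<open>S\<^sub>n\<close> is a function that permutes \<open>{1..n}\<close>; its one-line notation is
  \<open>\<pi> 1, \<dots>, \<pi> n\<close>.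
\<close>

definition avoids_132 :: "nat \<Rightarrow> (nat \<Rightarrow> nat) \<Rightarrow> bool" where
  "avoids_132 n \<pi> \<longleftrightarrow>
     \<not> (\<exists>i j k. 1 \<le> i \<and> i < j \<and> j < k \<and> k \<le> n \<and> \<pi> i < \<pi> k \<and> \<pi> k < \<pi> j)"

definition A2 :: "nat \<Rightarrow> (nat \<Rightarrow> nat) set" where
  "A2 n = {\<pi>. \<pi> permutes {1..n} \<and> avoids_132 n \<pi> \<and>
             (\<forall>i. 1 \<le> i \<and> i < n \<longrightarrow> \<bar>int (\<pi> (i + 1)) - int (\<pi> i)\<bar> \<le> 2)}"

definition B :: "nat \<Rightarrow> (nat \<Rightarrow> nat) set" where
  "B n = {\<pi> \<in> A2 n. \<pi> 1 = n}"

text \<open>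
  For \<open>n < 2\<close> there is no second entry; \<open>\<pi> 2 = 2\<close> there, so \<open>C n\<close> is empty.
\<close>

definition C :: "nat \<Rightarrow> (nat \<Rightarrow> nat) set" where
  "C n = {\<pi> \<in> A2 n. \<pi> 2 = n}"

end

theory Submission
  imports Defs
begin

text \<open>
  If \<open>\<pi> 2 = n\<close>, then avoiding \<open>132\<close> forces \<open>\<pi> 1\<close> above all later entries, so \<open>\<pi> 1 = n - 1\<close>.
  The remaining entries are those of \<open>{1..n - 2}\<close>, and the first of them is within \<open>2\<close> of \<open>n\<close>,
  so it is \<open>n - 2\<close>. Hence deleting the prefix \<open>n - 1, n\<close> maps \<open>C n\<close> into \<open>B (n - 2)\<close>, and
  prepending it is the inverse.
\<close>

text \<open>The kept entries already form \<open>{1..m}\<close>, so no relabelling of values is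
  needed. Points outside are fixed because \<open>permutes\<close> demands it.\<close>

definition delete_prefix :: "nat \<Rightarrow> (nat \<Rightarrow> nat) \<Rightarrow> nat \<Rightarrow> nat" where
  "delete_prefix m \<pi> i = (if i \<in> {1..m} then \<pi> (i + 2) else i)"

definition add_prefix :: "nat \<Rightarrow> (nat \<Rightarrow> nat) \<Rightarrow> nat \<Rightarrow> nat" where
  "add_prefix m \<sigma> i =
     (if i = 1 then m + 1 else if i = 2 then m + 2 else if i \<in> {3..m + 2} then \<sigma> (i - 2) else i)"

text \<open>An injective self-map of a finite set is onto, so surjectivity need not be checked
  separately.\<close>

lemma permutes_finiteI:
  assumes "finite S" "inj_on f S" "\<And>x. x \<in> S \<Longrightarrow> f x \<in> S" "\<And>x. x \<notin> S \<Longrightarrow> f x = x"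
  shows "f permutes S"
proof (rule bij_imp_permutes)
  show "bij_betw f S S"
    using assms endo_inj_surj[of S f] by (auto simp: bij_betw_def)
qed (use assms in auto)

lemma C_prefix:
  assumes "\<pi> \<in> C (m + 2)" and "1 \<le> m"
  shows "\<pi> 1 = m + 1" "\<pi> 2 = m + 2" "\<And>i. i \<in> {3..m + 2} \<Longrightarrow> \<pi> i \<in> {1..m}" "\<pi> 3 = m"
proof -
  have perm: "\<pi> permutes {1..m + 2}" and av: "avoids_132 (m + 2) \<pi>"
    and step: "\<And>i. 1 \<le> i \<Longrightarrow> i < m + 2 \<Longrightarrow> \<bar>int (\<pi> (i + 1)) - int (\<pi> i)\<bar> \<le> 2"
    and two: "\<pi> 2 = m + 2"
    using assms by (auto simp: C_def A2_def)
  have ran: "\<pi> i \<in> {1..m + 2}" if "i \<in> {1..m + 2}" for i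
    using that permutes_in_image[OF perm] by blast
  have inj: "\<pi> i = \<pi> j \<longleftrightarrow> i = j" for i j
    using permutes_inj[OF perm] by (auto dest: injD)
  have later: "\<pi> k < \<pi> 1" if "k \<in> {3..m + 2}" for k
  proof -
    have "\<pi> k < \<pi> 2" using ran[of k] inj[of k 2] that two by auto
    \<comment> \<open>Otherwise positions 1, 2, \<open>k\<close> would form a 132 pattern with the
      maximum in the middle.\<close>
    then have "\<not> \<pi> 1 < \<pi> k" using av that by (fastforce simp: avoids_132_def)
    then show ?thesis using inj[of k 1] that by auto
  qed
  have "m + 1 \<in> \<pi> ` {1..m + 2}"
    unfolding permutes_image[OF perm] by simp
  then obtain j where j: "\<pi> j = m + 1" "j \<in> {1..m + 2}"
    by (metis imageE)
  show one: "\<pi> 1 = m + 1"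
  proof (rule ccontr)
    assume "\<pi> 1 \<noteq> m + 1"
    then have "j \<in> {3..m + 2}" using j two by (cases "j = 1"; cases "j = 2") auto
    \<comment> \<open>Now \<open>\<pi> 1\<close> can only be the maximum \<open>m + 2\<close>, which
      position 2 already holds.\<close>
    then have "m + 1 < \<pi> 1" using later j by metis
    then have "\<pi> 1 = \<pi> 2" using ran[of 1] two by auto
    then show False using inj by simp
  qed
  show rest: "\<pi> i \<in> {1..m}" if "i \<in> {3..m + 2}" for i
    using later[OF that] ran[of i] that one by auto
  \<comment> \<open>The step from \<open>m + 2\<close> gives at least \<open>m\<close>, and
    \<open>rest\<close> gives at most \<open>m\<close>; position 3 exists since
    \<open>1 \<le> m\<close>.\<close>
  show "\<pi> 3 = m"
    using rest[of 3] step[of 2] two assms by auto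
qed (use assms in \<open>simp add: C_def\<close>)

text \<open>Avoidance and the step bound pass to a block of consecutive positions, and the new first
  entry is \<open>\<pi> 3\<close>.\<close>

lemma delete_prefix_in_B:
  assumes "\<pi> \<in> C (m + 2)" and "1 \<le> m"
  shows "delete_prefix m \<pi> \<in> B m"
proof -
  note pre = C_prefix[OF assms]
  have perm: "\<pi> permutes {1..m + 2}" and av: "avoids_132 (m + 2) \<pi>"
    and step: "\<And>i. 1 \<le> i \<Longrightarrow> i < m + 2 \<Longrightarrow> \<bar>int (\<pi> (i + 1)) - int (\<pi> i)\<bar> \<le> 2"
    using assms by (auto simp: C_def A2_def)
  have "delete_prefix m \<pi> permutes {1..m}"
  proof (rule permutes_finiteI)
    show "inj_on (delete_prefix m \<pi>) {1..m}"
      using permutes_inj[OF perm] by (auto simp: inj_on_def delete_prefix_def dest: injD)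
    show "delete_prefix m \<pi> i \<in> {1..m}" if "i \<in> {1..m}" for i
      using that pre(3)[of "i + 2"] by (auto simp: delete_prefix_def)
  qed (auto simp: delete_prefix_def)
  moreover have "avoids_132 m (delete_prefix m \<pi>)"
    unfolding avoids_132_def
  proof clarify
    fix i j k
    assume "1 \<le> i" "i < j" "j < k" "k \<le> m" "delete_prefix m \<pi> i < delete_prefix m \<pi> k"
      "delete_prefix m \<pi> k < delete_prefix m \<pi> j"
    then have "1 \<le> i + 2 \<and> i + 2 < j + 2 \<and> j + 2 < k + 2 \<and> k + 2 \<le> m + 2 \<and>
        \<pi> (i + 2) < \<pi> (k + 2) \<and> \<pi> (k + 2) < \<pi> (j + 2)"
      by (simp add: delete_prefix_def)
    then show False using av unfolding avoids_132_def by blast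
  qed
  moreover have "\<bar>int (delete_prefix m \<pi> (i + 1)) - int (delete_prefix m \<pi> i)\<bar> \<le> 2"
    if "1 \<le> i" "i < m" for i
    using that step[of "i + 2"] by (simp add: delete_prefix_def)
  moreover have "delete_prefix m \<pi> 1 = m"
    using pre(4) assms by (simp add: delete_prefix_def numeral_3_eq_3)
  ultimately show ?thesis by (simp add: B_def A2_def)
qed

text \<open>Both prefix entries exceed everything after them, so a 132 pattern would have to lie
  inside \<open>\<sigma>\<close>.\<close>

lemma add_prefix_in_C:
  assumes "\<sigma> \<in> B m" and "1 \<le> m"
  shows "add_prefix m \<sigma> \<in> C (m + 2)"
proof -
  have perm: "\<sigma> permutes {1..m}" and av: "avoids_132 m \<sigma>"
    and step: "\<And>i. 1 \<le> i \<Longrightarrow> i < m \<Longrightarrow> \<bar>int (\<sigma> (i + 1)) - int (\<sigma> i)\<bar> \<le> 2"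
    and one: "\<sigma> 1 = m"
    using assms by (auto simp: B_def A2_def)
  have low: "add_prefix m \<sigma> i \<in> {1..m}" if "i \<in> {3..m + 2}" for i
    using that permutes_in_image[OF perm, of "i - 2"] by (auto simp: add_prefix_def)
  have p1: "add_prefix m \<sigma> 1 = m + 1" and p2: "add_prefix m \<sigma> 2 = m + 2"
    by (simp_all add: add_prefix_def)
  have split: "i = 1 \<or> i = 2 \<or> i \<in> {3..m + 2}" if "i \<in> {1..m + 2}" for i
    using that by auto
  have "add_prefix m \<sigma> permutes {1..m + 2}"
  proof (rule permutes_finiteI)
    have "i - 2 = j - 2" if "add_prefix m \<sigma> i = add_prefix m \<sigma> j"
      "i \<in> {3..m + 2}" "j \<in> {3..m + 2}" for i j
      using that permutes_inj[OF perm] by (auto simp: add_prefix_def dest: injD)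
    \<comment> \<open>Truncated subtraction is harmless here: \<open>i\<close> and \<open>j\<close>
      are at least 3, so \<open>i - 2 = j - 2\<close> gives \<open>i = j\<close>.\<close>
    then have "inj_on (add_prefix m \<sigma>) {3..m + 2}"
      by (force intro!: inj_onI)
    moreover have "{1..m + 2} = insert 1 (insert 2 {3..m + 2})" by auto
    moreover have "m + 1 \<notin> add_prefix m \<sigma> ` {3..m + 2}" "m + 2 \<notin> add_prefix m \<sigma> ` {3..m + 2}"
      using low by fastforce+
    ultimately show "inj_on (add_prefix m \<sigma>) {1..m + 2}"
      using p1 p2 by simp
    show "add_prefix m \<sigma> i \<in> {1..m + 2}" if "i \<in> {1..m + 2}" for i
      using split[OF that] low[of i] p1 p2 by auto
  qed (auto simp: add_prefix_def)
  moreover have "avoids_132 (m + 2) (add_prefix m \<sigma>)"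
    unfolding avoids_132_def
  proof clarify
    fix i j k
    assume ijk: "1 \<le> i" "i < j" "j < k" "k \<le> m + 2"
      and lt: "add_prefix m \<sigma> i < add_prefix m \<sigma> k" "add_prefix m \<sigma> k < add_prefix m \<sigma> j"
    \<comment> \<open>Since \<open>k\<close> is at least 3, its entry lies below both prefix
      entries, so the smaller entry at \<open>i\<close> is not in the prefix.\<close>
    have "add_prefix m \<sigma> k \<le> m" using low[of k] ijk by auto
    then have "i \<noteq> 1" "i \<noteq> 2" using lt p1 p2 by auto
    then have "1 \<le> i - 2 \<and> i - 2 < j - 2 \<and> j - 2 < k - 2 \<and> k - 2 \<le> m \<and>
        \<sigma> (i - 2) < \<sigma> (k - 2) \<and> \<sigma> (k - 2) < \<sigma> (j - 2)"
      using ijk lt by (auto simp: add_prefix_def)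
    then show False using av unfolding avoids_132_def by blast
  qed
  moreover have "\<bar>int (add_prefix m \<sigma> (i + 1)) - int (add_prefix m \<sigma> i)\<bar> \<le> 2"
    if i: "1 \<le> i" "i < m + 2" for i
  proof -
    \<comment> \<open>The two new steps have sizes 1 and 2, the latter because
      \<open>\<sigma> 1 = m\<close>; all others come from \<open>\<sigma>\<close>.\<close>
    consider "i = 1" | "i = 2" | "i \<ge> 3" using i by linarith
    then show ?thesis
    proof cases
      case 3
      then have "i + 1 - 2 = i - 2 + 1" by simp
      with 3 i step[of "i - 2"] show ?thesis by (simp add: add_prefix_def)
    qed (use one assms in \<open>simp_all add: add_prefix_def\<close>)
  qed
  ultimately show ?thesis using p2 by (simp add: C_def A2_def)
qed

text \<open>Deletion loses nothing, since the first two entries are the same for every member of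
  \<open>C (m + 2)\<close>.\<close>

lemma add_prefix_delete_prefix:
  assumes "\<pi> \<in> C (m + 2)" and "1 \<le> m"
  shows "add_prefix m (delete_prefix m \<pi>) = \<pi>"
proof
  fix i
  have "\<pi> permutes {1..m + 2}" using assms by (simp add: C_def A2_def)
  then have "\<pi> i = i" if "i \<notin> {1..m + 2}" using that by (rule permutes_not_in)
  moreover have "Suc (Suc (i - 2)) = i" if "3 \<le> i" using that by simp
  ultimately show "add_prefix m (delete_prefix m \<pi>) i = \<pi> i"
    using C_prefix(1,2)[OF assms] by (auto simp: add_prefix_def delete_prefix_def)
qed

lemma delete_prefix_add_prefix:
  assumes "\<sigma> \<in> B m"
  shows "delete_prefix m (add_prefix m \<sigma>) = \<sigma>"
proof
  fix i
  have "\<sigma> permutes {1..m}" using assms by (simp add: B_def A2_def)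
  then have "\<sigma> i = i" if "i \<notin> {1..m}" using that by (rule permutes_not_in)
  then show "delete_prefix m (add_prefix m \<sigma>) i = \<sigma> i"
    by (auto simp: add_prefix_def delete_prefix_def)
qed

theorem lemma4p8:
  fixes n :: nat
  assumes "n \<ge> 3"
  shows "card (C n) = card (B (n - 2))"
proof -
  define m where "m = n - 2"
  have m: "1 \<le> m" "n = m + 2" using assms by (auto simp: m_def)
  have "bij_betw (delete_prefix m) (C (m + 2)) (B m)"
    using m(1) add_prefix_delete_prefix delete_prefix_add_prefix delete_prefix_in_B add_prefix_in_C
    by (intro bij_betw_byWitness[where f' = "add_prefix m"]) auto
  then show ?thesis using m(2) by (simp add: bij_betw_same_card)
qed

end
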